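(* Let $r,n\ge1$ and let $\alpha=(\alpha_1,\dots,\alpha_k)$ be a composition of $n$. Then \[ \sum_{\sigma\in\mathcal{OP}^r_{n,\alpha}} q^{\mathrm{inv}(\sigma)}=\sum_{\sigma\in\mathcal{OP}^r_{n,\alpha}} q^{\mathrm{minimaj}(\sigma)}=([r]_q)^n F_{n,\alpha}(q^r), \] where $F_{n,\alpha}(q):=\prod_{i=1}^k\sum_{j=0}^{\alpha_1+\cdots+\alpha_{i-1}}\binom{\alpha_i-1+j}{\alpha_i-1}q^j$.
   Context: $[r]_q=1+q+\cdots+q^{r-1}$. Let $\mathcal{A}_{n,r}=\{i^j:1\le i\le n,\,0\le j\le r-1\}$ (letter $i$ with color $j$), totally ordered by $1^{r-1}\prec\cdots\prec n^{r-1}\prec 1^{r-2}\prec\cdots\prec n^{r-2}\prec\cdots\prec 1^0\prec\cdots\prec n^0$. A colored permutation is a word $\pi_1\dots\pi_n$ in $\mathcal{A}_{n,r}$ containing exactly one copy (of some color) of each $i\in[n]$; with color sequence $(\epsilon_1,\dots,\epsilon_n)$ its major index is $\mathrm{maj}(\pi)=r\sum_{i:\pi_{i+1}\prec\pi_i}i+\sum_{i}\epsilon_i$. A colored ordered set partition is a sequence $\sigma=(B_1|\dots|B_k)$ of nonempty subsets of $\mathcal{A}_{n,r}$ such that for each $i\in[n]$ exactly one copy of $i$ (of exactly one color) appears among the blocks; its shape is $(|B_1|,\dots,|B_k|)$, and $\mathcal{OP}^r_{n,\alpha}$ is the set of those of shape $\alpha$. $C\wr S(\sigma)$ is the set of colored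 permutations obtained by writing the blocks in order with letters within each block in any order; $\mathrm{minimaj}(\sigma)=\min\{\mathrm{maj}(\pi):\pi\in C\wr S(\sigma)\}$. Let $d(\sigma)$ be the ordered set partition of $[n]$ obtained by erasing colors, and $\epsilon(\sigma)$ the sum of the colors of all letters of $\sigma$. Define $\mathrm{inv}(\sigma)=r\cdot\mathrm{inv}(d(\sigma))+\epsilon(\sigma)$, where for an ordered set partition $(C_1|\dots|C_k)$ of $[n]$, $\mathrm{inv}$ counts pairs $i<j$ with $j\in C_\ell$ and $i=\min(C_m)$ for some $\ell<m$. *)

theory Defs
  imports "HOL-Computational_Algebra.Polynomial"
begin

text \<open>The letter \<open>i\<close> with color \<open>j\<close> is the pair \<open>(i, j)\<close>.\<close>

type_synonym letter = "nat \<times> nat"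

definition alphabet :: "nat \<Rightarrow> nat \<Rightarrow> letter set" where
  "alphabet n r = {1..n} \<times> {0..<r}"

definition letter_less :: "letter \<Rightarrow> letter \<Rightarrow> bool" (infix "\<prec>" 50) where
  "x \<prec> y \<longleftrightarrow> snd y < snd x \<or> (snd x = snd y \<and> fst x < fst y)"

definition colored_perms :: "nat \<Rightarrow> nat \<Rightarrow> letter list set" where
  "colored_perms n r =
    {\<pi>. set \<pi> \<subseteq> alphabet n r \<and> distinct (map fst \<pi>) \<and> fst ` set \<pi> = {1..n}}"

text \<open>Lists are indexed from 0, so the word \<open>\<pi>\<^sub>1 \<dots> \<pi>\<^sub>n\<close> has \<open>\<pi>\<^sub>i = \<pi> ! (i - 1)\<close>;
  descents keep their 1-based positions.\<close>

definition maj :: "nat \<Rightarrow> letter list \<Rightarrow> nat" where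
  "maj r \<pi> = r * (\<Sum>i | 1 \<le> i \<and> i < length \<pi> \<and> \<pi> ! i \<prec> \<pi> ! (i - 1). i)
            + (\<Sum>x\<leftarrow>\<pi>. snd x)"

definition colored_osps :: "nat \<Rightarrow> nat \<Rightarrow> letter set list set" where
  "colored_osps n r =
    {\<sigma>. (\<forall>B\<in>set \<sigma>. B \<noteq> {} \<and> B \<subseteq> alphabet n r) \<and>
         (\<forall>i\<in>{1..n}. \<exists>!(m, c). m < length \<sigma> \<and> (i, c) \<in> \<sigma> ! m)}"

definition shape :: "'a set list \<Rightarrow> nat list" where
  "shape \<sigma> = map card \<sigma>"

definition colored_osps_of_shape :: "nat \<Rightarrow> nat \<Rightarrow> nat list \<Rightarrow> letter set list set" where
  "colored_osps_of_shape n r \<alpha> = {\<sigma> \<in> colored_osps n r. shape \<sigma> = \<alpha>}"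

text \<open>The words of a colored ordered set partition: the blocks, in order, each written
  out in an arbitrary order.  That these are colored permutations is
  \<open>block_words_colored_perms\<close> below.\<close>

definition block_words :: "letter set list \<Rightarrow> letter list set" where
  "block_words \<sigma> = {concat ws | ws. list_all2 (\<lambda>w B. distinct w \<and> set w = B) ws \<sigma>}"

definition minimaj :: "nat \<Rightarrow> letter set list \<Rightarrow> nat" where
  "minimaj r \<sigma> = Min (maj r ` block_words \<sigma>)"

definition erase_colors :: "letter set list \<Rightarrow> nat set list" where
  "erase_colors \<sigma> = map ((`) fst) \<sigma>"

definition color_sum :: "letter set list \<Rightarrow> nat" where
  "color_sum \<sigma> = (\<Sum>B\<leftarrow>\<sigma>. \<Sum>x\<in>B. snd x)"

definition osp_inv :: "nat set list \<Rightarrow> nat" where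
  "osp_inv C = card {(i, j). i < j \<and>
     (\<exists>l m. l < m \<and> m < length C \<and> j \<in> C ! l \<and> i = Min (C ! m))}"

definition colored_inv :: "nat \<Rightarrow> letter set list \<Rightarrow> nat" where
  "colored_inv r \<sigma> = r * osp_inv (erase_colors \<sigma>) + color_sum \<sigma>"

definition is_composition :: "nat list \<Rightarrow> nat \<Rightarrow> bool" where
  "is_composition \<alpha> n \<longleftrightarrow> (\<forall>a\<in>set \<alpha>. 1 \<le> a) \<and> sum_list \<alpha> = n"

definition q_int :: "nat \<Rightarrow> int poly" where
  "q_int r = (\<Sum>j<r. monom 1 j)"

definition F_poly :: "nat list \<Rightarrow> int poly" where
  "F_poly \<alpha> = (\<Prod>i<length \<alpha>. \<Sum>j = 0..sum_list (take i \<alpha>).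
     monom (int ((\<alpha> ! i - 1 + j) choose (\<alpha> ! i - 1))) j)"

text \<open>Sanity checks: the sums and the minimum are over finite (and, for the minimum, nonempty)
  sets, so that the conventions for \<^const>\<open>sum\<close> and \<^const>\<open>Min\<close> outside that range play no role.\<close>

lemma finite_alphabet: "finite (alphabet n r)"
  by (simp add: alphabet_def)

lemma finite_colored_osps_of_shape: "finite (colored_osps_of_shape n r \<alpha>)"
proof (rule finite_subset)
  show "colored_osps_of_shape n r \<alpha> \<subseteq>
      {\<sigma>. set \<sigma> \<subseteq> Pow (alphabet n r) \<and> length \<sigma> = length \<alpha>}"
  proof
    fix \<sigma> assume \<sigma>: "\<sigma> \<in> colored_osps_of_shape n r \<alpha>"
    then have "\<forall>B\<in>set \<sigma>. B \<subseteq> alphabet n r"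
      unfolding colored_osps_of_shape_def colored_osps_def by blast
    moreover have "length \<sigma> = length \<alpha>"
      using \<sigma> unfolding colored_osps_of_shape_def shape_def by auto
    ultimately show "\<sigma> \<in> {\<sigma>. set \<sigma> \<subseteq> Pow (alphabet n r) \<and> length \<sigma> = length \<alpha>}" by blast
  qed
  show "finite {\<sigma>. set \<sigma> \<subseteq> Pow (alphabet n r) \<and> length \<sigma> = length \<alpha>}"
    by (intro finite_lists_length_eq) (simp add: finite_alphabet)
qed

lemma block_words_set_length:
  assumes "list_all2 (\<lambda>w B. distinct w \<and> set w = B) ws \<sigma>"
  shows "set (concat ws) = \<Union>(set \<sigma>)" and "length (concat ws) = sum_list (map card \<sigma>)"
  using assms by (induction rule: list_all2_induct) (auto simp: distinct_card)

lemma block_words_colored_perms: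
  assumes "is_composition \<alpha> n" and \<sigma>: "\<sigma> \<in> colored_osps_of_shape n r \<alpha>"
  shows "block_words \<sigma> \<subseteq> colored_perms n r"
proof
  fix \<pi> assume "\<pi> \<in> block_words \<sigma>"
  then obtain ws where ws: "\<pi> = concat ws"
      "list_all2 (\<lambda>w B. distinct w \<and> set w = B) ws \<sigma>"
    by (auto simp: block_words_def)
  have S: "set \<pi> = \<Union>(set \<sigma>)" and L: "length \<pi> = sum_list (map card \<sigma>)"
    using block_words_set_length[OF ws(2)] ws(1) by auto
  have sub: "set \<pi> \<subseteq> alphabet n r"
    using \<sigma> unfolding S colored_osps_of_shape_def colored_osps_def by blast
  have "i \<in> fst ` set \<pi>" if "i \<in> {1..n}" for i
  proof -
    have "\<forall>i\<in>{1..n}. \<exists>!(m, c). m < length \<sigma> \<and> (i, c) \<in> \<sigma> ! m"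
      using \<sigma> unfolding colored_osps_of_shape_def colored_osps_def by (elim CollectE conjE)
    then have "\<exists>!(m, c). m < length \<sigma> \<and> (i, c) \<in> \<sigma> ! m"
      using that by (rule bspec)
    then obtain m c where "m < length \<sigma>" "(i, c) \<in> \<sigma> ! m" by blast
    then have "(i, c) \<in> set \<pi>" unfolding S by (meson UnionI nth_mem)
    then show ?thesis by force
  qed
  then have F: "fst ` set \<pi> = {1..n}"
    using sub unfolding alphabet_def by fastforce
  have sh: "map card \<sigma> = \<alpha>"
    using \<sigma> unfolding colored_osps_of_shape_def shape_def by (elim CollectE conjE)
  have "length (map fst \<pi>) = n"
    using assms(1) L sh unfolding is_composition_def by simp
  then have "distinct (map fst \<pi>)"
    by (intro card_distinct) (simp add: F)
  with sub F show "\<pi> \<in> colored_perms n r" unfolding colored_perms_def by blast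
qed

lemma finite_block_words:
  assumes "is_composition \<alpha> n" and "\<sigma> \<in> colored_osps_of_shape n r \<alpha>"
  shows "finite (block_words \<sigma>)"
proof (rule finite_subset)
  have "\<pi> \<in> {\<pi>. set \<pi> \<subseteq> alphabet n r \<and> distinct \<pi>}" if "\<pi> \<in> colored_perms n r" for \<pi>
    using that unfolding colored_perms_def distinct_map by blast
  then show "block_words \<sigma> \<subseteq> {\<pi>. set \<pi> \<subseteq> alphabet n r \<and> distinct \<pi>}"
    using block_words_colored_perms[OF assms] by blast
  show "finite {\<pi>. set \<pi> \<subseteq> alphabet n r \<and> distinct \<pi>}"
    by (rule finite_subset_distinct) (rule finite_alphabet)
qed

lemma block_words_nonempty:
  assumes "\<sigma> \<in> colored_osps_of_shape n r \<alpha>"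
  shows "block_words \<sigma> \<noteq> {}"
proof -
  have "\<forall>B\<in>set \<sigma>. B \<subseteq> alphabet n r"
    using assms unfolding colored_osps_of_shape_def colored_osps_def by blast
  then have "\<forall>B\<in>set \<sigma>. finite B"
    by (meson finite_subset finite_alphabet)
  then have "\<exists>ws. list_all2 (\<lambda>w B. distinct w \<and> set w = B) ws \<sigma>"
  proof (induction \<sigma>)
    case (Cons B \<sigma>)
    then obtain ws where "list_all2 (\<lambda>w B. distinct w \<and> set w = B) ws \<sigma>" by auto
    moreover obtain w where "set w = B" "distinct w"
      using Cons.prems finite_distinct_list[of B] by auto
    ultimately have "list_all2 (\<lambda>w B. distinct w \<and> set w = B) (w # ws) (B # \<sigma>)" by simp
    then show ?case by blast
  qed simp
  then show ?thesis by (auto simp: block_words_def)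
qed

end

theory Submission
  imports Defs "HOL-Library.FuncSet"
begin

text \<open>
  For a fixed coloring the letters are linearly ordered, so it suffices to treat ordered set
  partitions of a finite set of naturals. Remove the last block \<open>B\<close> and let \<open>w = Min B\<close>.
  The statistic inv drops by the number \<open>g\<close> of remaining letters exceeding \<open>w\<close>. For minimaj,
  writing \<open>B\<close> increasingly is always optimal: any other order has a descent inside \<open>B\<close>, which
  costs more than a descent just before \<open>B\<close>. So one minimises the major index of words \<open>\<pi> w\<close>,
  where \<open>\<pi>\<close> arranges the remaining blocks. Rotating the order cyclically so that \<open>w\<close> becomes
  the top lowers this major index by exactly \<open>g\<close>, hence minimaj also drops by \<open>g\<close>, up to a
  relabelling of the remaining letters. Both statistics thus satisfy the same recursion, and
  summing \<open>q ^ g\<close> over the choices of \<open>B\<close> gives the last factor of the product.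
\<close>

section \<open>Ordered set partitions of a given shape\<close>

text \<open>Nonemptiness of the blocks is left to the shape: a positive entry of
  \<open>\<alpha>\<close> forces its block to be nonempty and finite. Hence the hypothesis
  \<open>0 \<notin> set \<alpha>\<close> wherever minima of blocks matter.\<close>

definition osps :: "'a set \<Rightarrow> nat list \<Rightarrow> 'a set list set" where
  "osps S \<alpha> = {\<tau>. sorted_wrt disjnt \<tau> \<and> \<Union>(set \<tau>) = S \<and> map card \<tau> = \<alpha>}"

lemma osps_Nil: "osps S [] = (if S = {} then {[]} else {})"
  by (auto simp: osps_def)

lemma osps_snoc:
  "osps S (\<alpha> @ [a]) =
    (\<lambda>(B, \<tau>). \<tau> @ [B]) ` (SIGMA B:{B. B \<subseteq> S \<and> card B = a}. osps (S - B) \<alpha>)"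
proof (intro equalityI subsetI)
  fix \<sigma> assume s: "\<sigma> \<in> osps S (\<alpha> @ [a])"
  then have "map card \<sigma> = \<alpha> @ [a]" by (simp add: osps_def)
  then obtain \<tau> B where [simp]: "\<sigma> = \<tau> @ [B]" "map card \<tau> = \<alpha>" "card B = a"
    by (auto simp: map_eq_append_conv)
  have "sorted_wrt disjnt \<tau>" "\<forall>A\<in>set \<tau>. disjnt A B" "\<Union>(set \<tau>) \<union> B = S"
    using s by (auto simp: osps_def sorted_wrt_append)
  then have "B \<subseteq> S" "\<tau> \<in> osps (S - B) \<alpha>"
    by (auto simp: osps_def disjnt_def)
  then show "\<sigma> \<in> (\<lambda>(B, \<tau>). \<tau> @ [B]) ` (SIGMA B:{B. B \<subseteq> S \<and> card B = a}. osps (S - B) \<alpha>)"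
    by force
next
  fix \<sigma> assume "\<sigma> \<in> (\<lambda>(B, \<tau>). \<tau> @ [B]) ` (SIGMA B:{B. B \<subseteq> S \<and> card B = a}. osps (S - B) \<alpha>)"
  then obtain B \<tau> where "\<sigma> = \<tau> @ [B]" "B \<subseteq> S" "card B = a" "\<tau> \<in> osps (S - B) \<alpha>" by auto
  then show "\<sigma> \<in> osps S (\<alpha> @ [a])"
    by (auto simp: osps_def sorted_wrt_append disjnt_def)
qed

lemma finite_osps: "finite S \<Longrightarrow> finite (osps S \<alpha>)"
  by (rule finite_subset[OF _ finite_lists_length_eq[of "Pow S" "length \<alpha>"]])
     (auto simp: osps_def)

lemma sum_osps_snoc:
  assumes "finite S"
  shows "(\<Sum>\<sigma>\<in>osps S (\<alpha> @ [a]). f \<sigma>) =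
    (\<Sum>B | B \<subseteq> S \<and> card B = a. \<Sum>\<tau>\<in>osps (S - B) \<alpha>. f (\<tau> @ [B]))"
proof -
  have "inj_on (\<lambda>(B, \<tau>). \<tau> @ [B]) (SIGMA B:{B. B \<subseteq> S \<and> card B = a}. osps (S - B) \<alpha>)"
    by (auto simp: inj_on_def)
  then show ?thesis
    unfolding osps_snoc
    by (subst sum.reindex) (auto simp: sum.Sigma assms finite_osps case_prod_unfold)
qed

lemma map_image_in_osps:
  assumes f: "inj_on f S" and \<tau>: "\<tau> \<in> osps S \<alpha>"
  shows "map ((`) f) \<tau> \<in> osps (f ` S) \<alpha>"
proof -
  have sub: "A \<subseteq> S" if "A \<in> set \<tau>" for A using \<tau> that by (auto simp: osps_def)
  have "sorted_wrt (\<lambda>A B. disjnt (f ` A) (f ` B)) \<tau>"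
  proof (rule sorted_wrt_mono_rel)
    show "sorted_wrt disjnt \<tau>" using \<tau> by (simp add: osps_def)
    show "disjnt (f ` A) (f ` B)" if "A \<in> set \<tau>" "B \<in> set \<tau>" "disjnt A B" for A B
      using inj_on_image_Int[OF f, of A B] sub that by (simp add: disjnt_def)
  qed
  moreover have "card (f ` A) = card A" if "A \<in> set \<tau>" for A
    using sub[OF that] f by (meson card_image inj_on_subset)
  ultimately show ?thesis
    using \<tau> by (auto simp: osps_def sorted_wrt_map)
qed

lemma osps_image:
  assumes "inj_on f S"
  shows "map ((`) f) ` osps S \<alpha> = osps (f ` S) \<alpha>"
proof (intro equalityI subsetI)
  fix \<sigma> assume s: "\<sigma> \<in> osps (f ` S) \<alpha>"
  define g where "g = inv_into S f"
  have "f ` g ` A = A" if "A \<in> set \<sigma>" for A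
    unfolding g_def by (rule image_inv_into_cancel[OF refl]) (use s that in \<open>auto simp: osps_def\<close>)
  then have "map ((`) f) (map ((`) g) \<sigma>) = \<sigma>"
    by (simp add: map_idI)
  moreover have "map ((`) g) \<sigma> \<in> osps (g ` f ` S) \<alpha>"
    by (rule map_image_in_osps[OF _ s]) (simp add: g_def inj_on_inv_into)
  moreover have "g ` f ` S = S"
    unfolding g_def using assms by (simp add: inv_into_image_cancel)
  ultimately show "\<sigma> \<in> map ((`) f) ` osps S \<alpha>" by (metis imageI)
qed (auto intro: map_image_in_osps[OF assms])

lemma inj_on_map_image_osps:
  assumes "inj_on f S"
  shows "inj_on (map ((`) f)) (osps S \<alpha>)"
proof (rule inj_onI)
  fix \<sigma> \<tau> assume *: "\<sigma> \<in> osps S \<alpha>" "\<tau> \<in> osps S \<alpha>" "map ((`) f) \<sigma> = map ((`) f) \<tau>"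
  have "inj_on ((`) f) (set \<sigma> \<union> set \<tau>)"
    using * by (intro inj_on_subset[OF inj_on_image_Pow[OF assms]]) (auto simp: osps_def)
  then show "\<sigma> = \<tau>" using *(3) by (simp add: inj_on_map_eq_map)
qed

text \<open>This change of variables serves twice: in the induction, where the letters left after
  removing a block are relabelled, and at the end, where \<open>{1..n}\<close> is replaced by a set
  of keys encoding the colored order.\<close>

lemma sum_osps_image:
  assumes "inj_on f S"
  shows "(\<Sum>\<tau>\<in>osps (f ` S) \<alpha>. g \<tau>) = (\<Sum>\<tau>\<in>osps S \<alpha>. g (map ((`) f) \<tau>))"
  by (subst osps_image[OF assms, symmetric])
     (simp add: sum.reindex inj_on_map_image_osps assms)

section \<open>Words obtained by writing out the blocks\<close>

text \<open>\<open>block_words\<close> for blocks over any type, so that colored letters and plain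
  numbers are treated alike.\<close>

definition arrangements :: "'a set list \<Rightarrow> 'a list set" where
  "arrangements \<sigma> = {concat ws | ws. list_all2 (\<lambda>w B. distinct w \<and> set w = B) ws \<sigma>}"

lemma block_words_eq_arrangements: "block_words = arrangements"
  by (simp add: block_words_def arrangements_def fun_eq_iff)

lemma arrangements_Nil: "arrangements [] = {[]}"
  by (auto simp: arrangements_def)

lemma arrangements_Cons:
  "arrangements (B # \<sigma>) = {v @ \<pi> | v \<pi>. distinct v \<and> set v = B \<and> \<pi> \<in> arrangements \<sigma>}"
proof (intro equalityI subsetI)
  fix \<pi> assume "\<pi> \<in> arrangements (B # \<sigma>)"
  then show "\<pi> \<in> {v @ \<pi> | v \<pi>. distinct v \<and> set v = B \<and> \<pi> \<in> arrangements \<sigma>}"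
    unfolding arrangements_def list_all2_Cons2 by fastforce
next
  fix \<pi> assume "\<pi> \<in> {v @ \<pi> | v \<pi>. distinct v \<and> set v = B \<and> \<pi> \<in> arrangements \<sigma>}"
  then obtain v ws where "\<pi> = concat (v # ws)"
      "list_all2 (\<lambda>w B. distinct w \<and> set w = B) (v # ws) (B # \<sigma>)"
    by (auto simp: arrangements_def)
  then show "\<pi> \<in> arrangements (B # \<sigma>)" unfolding arrangements_def by blast
qed

lemma arrangements_Cons_image:
  "arrangements (B # \<sigma>) = (\<lambda>(v, \<pi>). v @ \<pi>) ` ({v. distinct v \<and> set v = B} \<times> arrangements \<sigma>)"
  by (auto simp: arrangements_Cons)

text \<open>\<open>arrangements_Cons\<close> peels off the first block, whereas the recursion for
  both statistics removes the last one.\<close>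

lemma arrangements_snoc:
  "arrangements (\<sigma> @ [B]) = {\<pi> @ v | \<pi> v. \<pi> \<in> arrangements \<sigma> \<and> distinct v \<and> set v = B}"
proof (induction \<sigma>)
  case Nil
  show ?case by (simp add: arrangements_Cons arrangements_Nil)
next
  case (Cons A \<sigma>)
  show ?case
  proof (intro equalityI subsetI)
    fix \<pi> assume "\<pi> \<in> arrangements ((A # \<sigma>) @ [B])"
    then obtain u \<rho> v where "\<pi> = (u @ \<rho>) @ v" "distinct u" "set u = A" "\<rho> \<in> arrangements \<sigma>"
        "distinct v" "set v = B"
      by (auto simp: arrangements_Cons Cons.IH)
    then show "\<pi> \<in> {\<pi> @ v | \<pi> v. \<pi> \<in> arrangements (A # \<sigma>) \<and> distinct v \<and> set v = B}"
      unfolding arrangements_Cons by blast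
  next
    fix \<pi> assume "\<pi> \<in> {\<pi> @ v | \<pi> v. \<pi> \<in> arrangements (A # \<sigma>) \<and> distinct v \<and> set v = B}"
    then obtain u \<rho> v where "\<pi> = u @ \<rho> @ v" "distinct u" "set u = A" "\<rho> \<in> arrangements \<sigma>"
        "distinct v" "set v = B"
      by (auto simp: arrangements_Cons)
    then show "\<pi> \<in> arrangements ((A # \<sigma>) @ [B])"
      unfolding append_Cons arrangements_Cons Cons.IH by blast
  qed
qed

lemma set_arrangements: "\<pi> \<in> arrangements \<sigma> \<Longrightarrow> set \<pi> = \<Union>(set \<sigma>)"
  by (induction \<sigma> arbitrary: \<pi>) (auto simp: arrangements_Nil arrangements_Cons)

lemma length_arrangements: "\<pi> \<in> arrangements \<sigma> \<Longrightarrow> length \<pi> = sum_list (map card \<sigma>)"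
  by (induction \<sigma> arbitrary: \<pi>)
     (auto simp: arrangements_Nil arrangements_Cons distinct_card)

lemma distinct_arrangements:
  "\<pi> \<in> arrangements \<sigma> \<Longrightarrow> sorted_wrt disjnt \<sigma> \<Longrightarrow> distinct \<pi>"
  by (induction \<sigma> arbitrary: \<pi>)
     (auto simp: arrangements_Nil arrangements_Cons set_arrangements disjnt_iff)

lemma finite_arrangements:
  assumes "\<forall>B\<in>set \<sigma>. finite B"
  shows "finite (arrangements \<sigma>)"
proof (rule finite_subset)
  show "arrangements \<sigma> \<subseteq> {\<pi>. set \<pi> \<subseteq> \<Union>(set \<sigma>) \<and> length \<pi> = sum_list (map card \<sigma>)}"
    using set_arrangements length_arrangements by blast
  show "finite {\<pi>. set \<pi> \<subseteq> \<Union>(set \<sigma>) \<and> length \<pi> = sum_list (map card \<sigma>)}"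
    using assms by (intro finite_lists_length_eq) auto
qed

lemma arrangements_nonempty:
  assumes "\<forall>B\<in>set \<sigma>. finite B"
  shows "arrangements \<sigma> \<noteq> {}"
  using assms
proof (induction \<sigma>)
  case (Cons B \<sigma>)
  then show ?case using finite_distinct_list[of B] by (fastforce simp: arrangements_Cons)
qed (simp add: arrangements_Nil)

lemma arrangements_image:
  assumes "inj_on f (\<Union>(set \<sigma>))"
  shows "arrangements (map ((`) f) \<sigma>) = map f ` arrangements \<sigma>"
  using assms
proof (induction \<sigma>)
  case (Cons B \<sigma>)
  have inj: "inj_on f B" by (rule inj_on_subset[OF Cons.prems]) auto
  have IH: "arrangements (map ((`) f) \<sigma>) = map f ` arrangements \<sigma>"
    by (rule Cons.IH, rule inj_on_subset[OF Cons.prems]) auto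
  have *: "{v. distinct v \<and> set v = f ` B} = map f ` {v. distinct v \<and> set v = B}"
  proof (intro equalityI subsetI)
    fix v assume "v \<in> {v. distinct v \<and> set v = f ` B}"
    then have v: "distinct v" "set v = f ` B" by auto
    have "f (inv_into B f x) = x" if "x \<in> set v" for x
      using that v(2) by (simp add: f_inv_into_f)
    then have "map f (map (inv_into B f) v) = v" by (simp add: map_idI)
    moreover have "set (map (inv_into B f) v) = B"
      using v inj by (simp add: inv_into_image_cancel)
    moreover have "distinct (map (inv_into B f) v)"
      using v by (simp add: distinct_map inj_on_inv_into)
    ultimately show "v \<in> map f ` {v. distinct v \<and> set v = B}"
      by (metis (mono_tags, lifting) imageI mem_Collect_eq)
  next
    fix v assume "v \<in> map f ` {v. distinct v \<and> set v = B}"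
    then show "v \<in> {v. distinct v \<and> set v = f ` B}"
      using inj by (fastforce simp: distinct_map)
  qed
  let ?D = "{v. distinct v \<and> set v = B}" and ?A = "arrangements \<sigma>"
  have "arrangements (map ((`) f) (B # \<sigma>)) = (\<lambda>(v, \<pi>). v @ \<pi>) ` (map f ` ?D \<times> map f ` ?A)"
    by (simp only: list.map arrangements_Cons_image IH *)
  also have "\<dots> = map f ` (\<lambda>(v, \<pi>). v @ \<pi>) ` (?D \<times> ?A)"
  proof (intro equalityI subsetI)
    fix \<pi> assume "\<pi> \<in> (\<lambda>(v, \<pi>). v @ \<pi>) ` (map f ` ?D \<times> map f ` ?A)"
    then obtain v \<rho> where "\<pi> = map f (v @ \<rho>)" "v \<in> ?D" "\<rho> \<in> ?A" by auto
    then show "\<pi> \<in> map f ` (\<lambda>(v, \<pi>). v @ \<pi>) ` (?D \<times> ?A)" by blast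
  next
    fix \<pi> assume "\<pi> \<in> map f ` (\<lambda>(v, \<pi>). v @ \<pi>) ` (?D \<times> ?A)"
    then obtain v \<rho> where "\<pi> = map f v @ map f \<rho>" "v \<in> ?D" "\<rho> \<in> ?A" by auto
    then show "\<pi> \<in> (\<lambda>(v, \<pi>). v @ \<pi>) ` (map f ` ?D \<times> map f ` ?A)" by blast
  qed
  finally show ?case by (simp only: arrangements_Cons_image)
qed (simp add: arrangements_Nil)

section \<open>Descent sums and rotation of the order\<close>

text \<open>The uncolored part of the major index, for any relation \<open>R\<close>: it is used
  with \<open>\<prec>\<close> on letters, with \<open><\<close> on numbers, and with the order that
  a coloring induces on \<open>{1..n}\<close>.\<close>

definition descent_sum :: "('a \<Rightarrow> 'a \<Rightarrow> bool) \<Rightarrow> 'a list \<Rightarrow> nat" where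
  "descent_sum R \<pi> = (\<Sum>i | 1 \<le> i \<and> i < length \<pi> \<and> R (\<pi> ! i) (\<pi> ! (i - 1)). i)"

lemma descent_sum_Nil: "descent_sum R [] = 0"
  by (simp add: descent_sum_def)

text \<open>For \<open>\<pi> = []\<close> the junk value \<open>last []\<close> is harmless, as the added position is \<open>0\<close>.\<close>

lemma descent_sum_snoc:
  "descent_sum R (\<pi> @ [x]) = descent_sum R \<pi> + (if R x (last \<pi>) then length \<pi> else 0)"
proof (cases "\<pi> = []")
  case True
  have "{i. 1 \<le> i \<and> i < Suc 0 \<and> R ([x] ! i) ([x] ! (i - 1))} = {}" by auto
  then show ?thesis unfolding descent_sum_def using True by simp
next
  case False
  let ?D = "{i. 1 \<le> i \<and> i < length \<pi> \<and> R (\<pi> ! i) (\<pi> ! (i - 1))}"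
  have "{i. 1 \<le> i \<and> i < length (\<pi> @ [x]) \<and> R ((\<pi> @ [x]) ! i) ((\<pi> @ [x]) ! (i - 1))} =
      ?D \<union> (if R x (last \<pi>) then {length \<pi>} else {})"
    using False by (auto simp: nth_append last_conv_nth Suc_le_eq less_Suc_eq split: if_splits)
  moreover have "finite ?D" by (rule finite_subset[of _ "{..<length \<pi>}"]) auto
  ultimately show ?thesis unfolding descent_sum_def by simp
qed

lemma descent_sum_map:
  assumes "\<And>x y. x \<in> set \<pi> \<Longrightarrow> y \<in> set \<pi> \<Longrightarrow> R (f x) (f y) \<longleftrightarrow> Q x y"
  shows "descent_sum R (map f \<pi>) = descent_sum Q \<pi>"
  unfolding descent_sum_def by (rule sum.cong) (auto simp: assms)

lemma maj_eq_descent_sum: "maj r \<pi> = r * descent_sum (\<prec>) \<pi> + (\<Sum>x\<leftarrow>\<pi>. snd x)"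
  by (simp add: maj_def descent_sum_def)

text \<open>On values less than \<open>K\<close> this cuts the order at \<open>w\<close> and swaps
  the two pieces, each keeping its internal order. The words it is applied to avoid
  \<open>w\<close>, so in the cyclic order \<open>w\<close> may be counted as the top, where
  appending it creates no descent.\<close>

definition rotate_below :: "nat \<Rightarrow> nat \<Rightarrow> nat \<Rightarrow> nat" where
  "rotate_below K w x = (if x < w then x + K else x)"

lemma inj_on_rotate_below: "\<forall>x\<in>S. x < K \<Longrightarrow> inj_on (rotate_below K w) S"
  by (fastforce simp: inj_on_def rotate_below_def split: if_splits)

text \<open>Moving one value from the top to the bottom of the order shifts the descent just after it
  to the position just before it; here this happens to every letter exceeding \<open>w\<close>.\<close>

lemma descent_sum_rotate_below:
  assumes "\<forall>x\<in>set \<pi>. x < K" and "w \<notin> set \<pi>"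
  shows "descent_sum (<) (\<pi> @ [w]) =
    descent_sum (<) (map (rotate_below K w) \<pi>) + length (filter ((<) w) \<pi>)"
  using assms
proof (induction \<pi> rule: rev_induct)
  case Nil
  then show ?case by (simp add: descent_sum_snoc[of _ "[]", simplified] descent_sum_Nil)
next
  case (snoc y \<pi>)
  have IH: "descent_sum (<) \<pi> + (if w < last \<pi> then length \<pi> else 0) =
      descent_sum (<) (map (rotate_below K w) \<pi>) + length (filter ((<) w) \<pi>)"
    using snoc by (simp add: descent_sum_snoc)
  show ?case
  proof (cases "\<pi> = []")
    case True
    then show ?thesis
      by (simp add: descent_sum_snoc[of _ "[]", simplified] descent_sum_snoc[of _ "[y]", simplified]
          descent_sum_Nil)
  next
    case False
    then have "last \<pi> \<in> set \<pi>" by simp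
    then have "last \<pi> < K" "last \<pi> \<noteq> w" "y < K" "y \<noteq> w" using snoc.prems by auto
    \<comment> \<open>On the same side of \<open>w\<close>, rotation keeps the comparison of
      \<open>y\<close> with \<open>last \<pi>\<close>; on opposite sides it reverses it, and exactly
      one of the two letters exceeds \<open>w\<close>, which balances the equation. A final descent
      from \<open>y\<close> to \<open>w\<close> costs one more than \<open>length \<pi>\<close>, and
      that unit counts \<open>y\<close> in the filter.\<close>
    then have step: "(if y < last \<pi> then length \<pi> else 0) + (if w < y then length \<pi> else 0) =
        (if rotate_below K w y < rotate_below K w (last \<pi>) then length \<pi> else 0) +
        (if w < last \<pi> then length \<pi> else 0)"
      by (auto simp: rotate_below_def)
    show ?thesis
      using IH step False
      by (simp add: descent_sum_snoc[of _ "\<pi> @ [y]", simplified] descent_sum_snoc last_map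
          split: if_splits)
  qed
qed

text \<open>A weakly increasing \<open>v\<close> has no descent inside, so only the junction with
  \<open>hd v\<close> can contribute.\<close>

lemma descent_sum_append_sorted:
  fixes v :: "nat list"
  assumes "sorted v" "v \<noteq> []"
  shows "descent_sum (<) (\<pi> @ v) = descent_sum (<) (\<pi> @ [hd v])"
  using assms
proof (induction v rule: rev_induct)
  case (snoc x v)
  show ?case
  proof (cases "v = []")
    case False
    then have "last v \<le> x" using snoc.prems by (auto simp: sorted_append)
    then show ?thesis
      using snoc False descent_sum_snoc[of "(<)" "\<pi> @ v" x] by (simp add: sorted_append)
  qed simp
qed simp

text \<open>An unsorted \<open>v\<close> has a descent in its interior, at a position beyond
  \<open>length \<pi>\<close>. The bound is the most that appending a single letter to
  \<open>\<pi>\<close> can cost.\<close>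

lemma descent_sum_append_unsorted:
  fixes v :: "nat list"
  assumes "\<not> sorted v"
  shows "descent_sum (<) \<pi> + length \<pi> \<le> descent_sum (<) (\<pi> @ v)"
  using assms
proof (induction v rule: rev_induct)
  case (snoc x v)
  show ?case
  proof (cases "sorted v")
    case False
    then show ?thesis using snoc descent_sum_snoc[of "(<)" "\<pi> @ v" x] by simp
  next
    case True
    then obtain y where "y \<in> set v" "x < y"
      using snoc.prems by (auto simp: sorted_append not_le)
    moreover have "y \<le> last v"
      using True \<open>y \<in> set v\<close> by (cases v rule: rev_cases) (auto simp: sorted_append)
    ultimately have "v \<noteq> []" "x < last v" by auto
    \<comment> \<open>The descent between \<open>v\<close> and \<open>x\<close> already supplies the
      summand \<open>length \<pi>\<close>; the rest only has to be bounded by the descents of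
      \<open>\<pi>\<close>.\<close>
    moreover have "descent_sum (<) \<pi> \<le> descent_sum (<) (\<pi> @ v)"
      using descent_sum_append_sorted[OF True \<open>v \<noteq> []\<close>] by (simp add: descent_sum_snoc)
    ultimately show ?thesis
      using descent_sum_snoc[of "(<)" "\<pi> @ v" x] by simp
  qed
qed simp

lemma descent_sum_append_Min_le:
  fixes v :: "nat list"
  assumes "distinct v" "v \<noteq> []"
  shows "descent_sum (<) (\<pi> @ [Min (set v)]) \<le> descent_sum (<) (\<pi> @ v)"
proof (cases "sorted v")
  case True
  then have "hd v = Min (set v)"
    using assms(2) by (cases v) (auto intro!: Min_eqI[symmetric])
  then show ?thesis using descent_sum_append_sorted[OF True assms(2), of \<pi>] by simp
next
  case False
  then show ?thesis
    using descent_sum_append_unsorted[of v \<pi>] by (simp add: descent_sum_snoc)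
qed

section \<open>Removing the last block\<close>

definition osp_minimaj :: "nat set list \<Rightarrow> nat" where
  "osp_minimaj \<sigma> = Min (descent_sum (<) ` arrangements \<sigma>)"

text \<open>Rotation changes the descent sum of every arrangement of \<open>\<sigma>\<close>
  followed by \<open>Min B\<close> by the same amount, since the number of letters exceeding
  \<open>Min B\<close> depends only on the set \<open>S - B\<close>. This constant can therefore be
  taken out of the minimum.\<close>

lemma osp_minimaj_snoc:
  assumes \<sigma>: "\<sigma> \<in> osps (S - B) \<alpha>" and fin: "finite S" and B: "B \<subseteq> S" "B \<noteq> {}"
    and K: "\<forall>x\<in>S. x < K"
  shows "osp_minimaj (\<sigma> @ [B]) =
    osp_minimaj (map ((`) (rotate_below K (Min B))) \<sigma>) + card {x \<in> S - B. Min B < x}"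
proof -
  let ?A = "arrangements \<sigma>" and ?w = "Min B" and ?d = "descent_sum (<) :: nat list \<Rightarrow> nat"
  let ?f = "\<lambda>\<pi>. ?d (map (rotate_below K ?w) \<pi>) + card {x \<in> S - B. ?w < x}"
  have finB: "finite B" using fin B finite_subset by blast
  have U: "\<Union>(set \<sigma>) = S - B" and disj: "sorted_wrt disjnt \<sigma>"
    using \<sigma> by (auto simp: osps_def)
  have blk: "\<forall>A\<in>set \<sigma>. finite A" using U fin by (metis Union_upper finite_Diff finite_subset)
  have finA: "finite ?A" "?A \<noteq> {}"
    using finite_arrangements arrangements_nonempty blk by blast+
  have rot: "?d (\<pi> @ [?w]) = ?f \<pi>" if "\<pi> \<in> ?A" for \<pi>
  proof -
    have s: "set \<pi> = S - B" using set_arrangements[OF that] U by simp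
    have "distinct \<pi>" using distinct_arrangements[OF that disj] .
    then have "length (filter ((<) ?w) \<pi>) = card {x \<in> S - B. ?w < x}"
      by (metis distinct_card distinct_filter s set_filter)
    moreover have "?w \<in> B" using finB B by simp
    ultimately show ?thesis
      using descent_sum_rotate_below[of \<pi> K ?w] s K by simp
  qed
  have "osp_minimaj (\<sigma> @ [B]) = Min (?f ` ?A)"
    unfolding osp_minimaj_def
  proof (rule Min_eqI)
    show "finite (?d ` arrangements (\<sigma> @ [B]))"
      using blk finB by (intro finite_imageI finite_arrangements) auto
    fix y assume "y \<in> ?d ` arrangements (\<sigma> @ [B])"
    then obtain \<pi> v where *: "\<pi> \<in> ?A" "distinct v" "set v = B" "y = ?d (\<pi> @ v)"
      by (auto simp: arrangements_snoc)
    have "?f \<pi> \<le> y"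
      using descent_sum_append_Min_le[of v \<pi>] * B rot[OF *(1)] by auto
    then show "Min (?f ` ?A) \<le> y"
      using finA *(1) by (meson Min_le dual_order.trans finite_imageI imageI)
  next
    \<comment> \<open>The lower bound is attained: a minimising \<open>\<pi>\<close> is followed by
      \<open>B\<close> in increasing order, whose head is \<open>Min B\<close>.\<close>
    have "Min (?f ` ?A) \<in> ?f ` ?A" using finA by (intro Min_in) auto
    then obtain \<pi> where p: "\<pi> \<in> ?A" "Min (?f ` ?A) = ?f \<pi>" by blast
    let ?v = "sorted_list_of_set B"
    have "?v \<noteq> []" using finB B by simp
    moreover from this have "hd ?v = ?w"
      using finB B by (simp add: sorted_list_of_set_nonempty)
    ultimately have "?d (\<pi> @ ?v) = ?f \<pi>"
      using descent_sum_append_sorted[of ?v \<pi>] rot[OF p(1)] by simp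
    moreover have "\<pi> @ ?v \<in> arrangements (\<sigma> @ [B])"
      using p(1) finB unfolding arrangements_snoc
      by (intro CollectI exI[of _ \<pi>] exI[of _ ?v]) simp
    ultimately show "Min (?f ` ?A) \<in> ?d ` arrangements (\<sigma> @ [B])"
      by (metis imageI p(2))
  qed
  also have "\<dots> = Min ((\<lambda>\<pi>. ?d (map (rotate_below K ?w) \<pi>)) ` ?A) + card {x \<in> S - B. ?w < x}"
    by (rule Min_add_commute) (use finA in auto)
  also have "(\<lambda>\<pi>. ?d (map (rotate_below K ?w) \<pi>)) ` ?A =
      ?d ` arrangements (map ((`) (rotate_below K ?w)) \<sigma>)"
    by (subst arrangements_image) (use K U in \<open>auto intro!: inj_on_rotate_below simp: image_image\<close>)
  finally show ?thesis by (simp add: osp_minimaj_def)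
qed

text \<open>The last block has no block after it, so its letters are never the larger entry of an
  inversion. The new pairs are exactly those with smaller entry \<open>Min B\<close>, and every
  larger letter outside \<open>B\<close> lies in an earlier block.\<close>

lemma osp_inv_snoc:
  assumes \<sigma>: "\<sigma> \<in> osps (S - B) \<alpha>" and fin: "finite S" and B: "B \<subseteq> S" "B \<noteq> {}"
    and pos: "0 \<notin> set \<alpha>"
  shows "osp_inv (\<sigma> @ [B]) = osp_inv \<sigma> + card {x \<in> S - B. Min B < x}"
proof -
  have U: "\<Union>(set \<sigma>) = S - B" using \<sigma> by (auto simp: osps_def)
  have minB: "Min B \<in> B" using finite_subset[OF B(1) fin] B by simp
  have min: "Min (\<sigma> ! m) \<in> S - B" if "m < length \<sigma>" for m
  proof -
    have sub: "\<sigma> ! m \<subseteq> S - B" using U that nth_mem by blast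
    have "card (\<sigma> ! m) \<in> set \<alpha>" using \<sigma> that by (auto simp: osps_def)
    \<comment> \<open>A nonzero cardinality makes the block both nonempty and finite, so that its
      \<open>Min\<close> is one of its elements.\<close>
    then have "card (\<sigma> ! m) \<noteq> 0" using pos by metis
    then have "\<sigma> ! m \<noteq> {}" "finite (\<sigma> ! m)" by (auto intro: card_ge_0_finite)
    then show ?thesis using sub Min_in by blast
  qed
  let ?P = "{(i, j). i < j \<and> (\<exists>l m. l < m \<and> m < length \<sigma> \<and> j \<in> \<sigma> ! l \<and> i = Min (\<sigma> ! m))}"
  let ?Q = "Pair (Min B) ` {x \<in> S - B. Min B < x}"
  have new: "(\<exists>l<length \<sigma>. j \<in> \<sigma> ! l) \<longleftrightarrow> j \<in> S - B" for j
    using U by (metis UnionE UnionI in_set_conv_nth nth_mem)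
  let ?C = "\<sigma> @ [B]"
  have "(\<exists>l m. l < m \<and> m < length ?C \<and> j \<in> ?C ! l \<and> i = Min (?C ! m)) \<longleftrightarrow>
      (\<exists>l m. l < m \<and> m < length \<sigma> \<and> j \<in> \<sigma> ! l \<and> i = Min (\<sigma> ! m)) \<or>
      (i = Min B \<and> (\<exists>l<length \<sigma>. j \<in> \<sigma> ! l))" (is "?lhs \<longleftrightarrow> ?rhs") for i j
  proof
    assume ?lhs
    then obtain l m where *: "l < m" "m < length ?C" "j \<in> ?C ! l" "i = Min (?C ! m)" by blast
    show ?rhs
    proof (cases "m < length \<sigma>")
      case True
      then have "j \<in> \<sigma> ! l" "i = Min (\<sigma> ! m)" using * by (auto simp: nth_append)
      then show ?thesis using True *(1) by blast
    next
      case False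
      then have "m = length \<sigma>" using *(2) by simp
      then have "l < length \<sigma>" "j \<in> \<sigma> ! l" "i = Min B" using * by (auto simp: nth_append)
      then show ?thesis by blast
    qed
  next
    assume ?rhs
    then show ?lhs
    proof (elim disjE exE conjE)
      fix l m assume "l < m" "m < length \<sigma>" "j \<in> \<sigma> ! l" "i = Min (\<sigma> ! m)"
      then show ?lhs by (intro exI[of _ l] exI[of _ m]) (simp add: nth_append)
    next
      fix l assume "i = Min B" "l < length \<sigma>" "j \<in> \<sigma> ! l"
      then show ?lhs by (intro exI[of _ l] exI[of _ "length \<sigma>"]) (simp add: nth_append)
    qed
  qed
  then have "{(i, j). i < j \<and> (\<exists>l m. l < m \<and> m < length ?C \<and> j \<in> ?C ! l \<and> i = Min (?C ! m))} =
      ?P \<union> ?Q"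
    unfolding new by auto
  \<comment> \<open>The first components separate the two sets: minima of the old blocks lie in
    \<open>S - B\<close>, while \<open>Min B\<close> lies in \<open>B\<close>.\<close>
  moreover have "?P \<inter> ?Q = {}" using min minB by auto
  moreover have "?P \<subseteq> S \<times> S"
  proof clarify
    fix i j l m
    assume "l < m" "m < length \<sigma>" "j \<in> \<sigma> ! l"
    then have "j \<in> S - B" using new by (meson less_trans)
    then show "Min (\<sigma> ! m) \<in> S \<and> j \<in> S" using min[OF \<open>m < length \<sigma>\<close>] by blast
  qed
  then have "finite ?P" using fin finite_subset by blast
  moreover have "finite ?Q" using fin by simp
  moreover have "card ?Q = card {x \<in> S - B. Min B < x}"
    by (rule card_image) (simp add: inj_on_def)
  ultimately show ?thesis unfolding osp_inv_def by (simp add: card_Un_disjoint)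
qed

section \<open>The generating function of both statistics\<close>

text \<open>Induction inserts an element \<open>m\<close> below all others. A subset avoiding
  \<open>m\<close> keeps its exponent, because \<open>m\<close> is not above its minimum. A subset
  containing \<open>m\<close> has minimum \<open>m\<close>, so everything outside it is counted; all
  these subsets share one exponent and together form the next term of the sum.\<close>

lemma sum_subsets_above_Min:
  fixes q :: "'a::comm_semiring_1" and S :: "nat set"
  assumes "finite S" and "a \<ge> 1"
  shows "(\<Sum>B | B \<subseteq> S \<and> card B = a. q ^ card {x \<in> S - B. Min B < x}) =
    (\<Sum>j<Suc (card S) - a. of_nat ((a - 1 + j) choose (a - 1)) * q ^ j)"
  using assms(1)
proof (induction S rule: finite_linorder_min_induct)
  case empty
  have "{B::nat set. B \<subseteq> {} \<and> card B = a} = {}" using assms(2) by auto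
  then show ?case using assms(2) by (simp only:) simp
next
  case (insert m S)
  have m: "m \<notin> S" using insert.hyps(2) by auto
  let ?F = "\<lambda>B. q ^ card {x \<in> insert m S - B. Min B < x}"
  let ?X = "{B. B \<subseteq> S \<and> card B = a}" and ?Y = "{C. C \<subseteq> S \<and> card C = a - 1}"
  have split: "{B. B \<subseteq> insert m S \<and> card B = a} = ?X \<union> insert m ` ?Y"
  proof (intro equalityI subsetI)
    fix B assume B: "B \<in> {B. B \<subseteq> insert m S \<and> card B = a}"
    then have f: "finite B" using insert.hyps(1) finite_subset by auto
    show "B \<in> ?X \<union> insert m ` ?Y"
    proof (cases "m \<in> B")
      case True
      then have "B = insert m (B - {m})" "B - {m} \<in> ?Y" using B f by auto
      then show ?thesis by blast
    qed (use B in auto)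
  next
    fix B assume "B \<in> ?X \<union> insert m ` ?Y"
    then show "B \<in> {B. B \<subseteq> insert m S \<and> card B = a}"
    proof
      assume "B \<in> insert m ` ?Y"
      then obtain C where C: "B = insert m C" "C \<subseteq> S" "card C = a - 1" by auto
      then have "finite C" "m \<notin> C" using insert.hyps(1) m finite_subset by auto
      then show ?thesis using C assms(2) by auto
    qed auto
  qed
  have "sum ?F {B. B \<subseteq> insert m S \<and> card B = a} = sum ?F ?X + sum ?F (insert m ` ?Y)"
    unfolding split using m insert.hyps(1) by (intro sum.union_disjoint) auto
  also have "sum ?F ?X = (\<Sum>B\<in>?X. q ^ card {x \<in> S - B. Min B < x})"
  proof (rule sum.cong[OF refl])
    fix B assume B: "B \<in> ?X"
    then have "B \<noteq> {}" "finite B" using assms(2) insert.hyps(1) finite_subset by auto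
    then have "Min B \<in> S" using B Min_in by blast
    then have "{x \<in> insert m S - B. Min B < x} = {x \<in> S - B. Min B < x}"
      using insert.hyps(2) by auto
    then show "?F B = q ^ card {x \<in> S - B. Min B < x}" by simp
  qed
  also have "sum ?F (insert m ` ?Y) = (\<Sum>C\<in>?Y. q ^ (Suc (card S) - a))"
  proof (subst sum.reindex)
    show "inj_on (insert m) ?Y" using m by (auto simp: inj_on_def)
    have "?F (insert m C) = q ^ (Suc (card S) - a)" if C: "C \<in> ?Y" for C
    proof -
      have fC: "finite C" using C insert.hyps(1) finite_subset by auto
      have "Min (insert m C) = m"
        using fC C insert.hyps(2) by (intro Min_eqI) (auto intro: less_imp_le)
      then have "{x \<in> insert m S - insert m C. Min (insert m C) < x} = S - C"
        using insert.hyps(2) m by auto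
      moreover have "card (S - C) = Suc (card S) - a"
        using C fC assms(2) by (simp add: card_Diff_subset)
      ultimately show ?thesis by simp
    qed
    then show "sum (?F \<circ> insert m) ?Y = (\<Sum>C\<in>?Y. q ^ (Suc (card S) - a))"
      by (intro sum.cong) (simp_all only: o_apply)
  qed
  also have "\<dots> = of_nat (card S choose (a - 1)) * q ^ (Suc (card S) - a)"
    using insert.hyps(1) by (simp add: n_subsets)
  finally have eq: "sum ?F {B. B \<subseteq> insert m S \<and> card B = a} =
      (\<Sum>j<Suc (card S) - a. of_nat ((a - 1 + j) choose (a - 1)) * q ^ j) +
      of_nat (card S choose (a - 1)) * q ^ (Suc (card S) - a)"
    unfolding insert.IH .
  show ?case
  proof (cases "a \<le> Suc (card S)")
    case True
    \<comment> \<open>The second equation identifies the binomial of the new term, at index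
      \<open>j = Suc (card S) - a\<close>, with \<open>card S choose (a - 1)\<close>.\<close>
    then have "Suc (card (insert m S)) - a = Suc (Suc (card S) - a)"
      "a - 1 + (Suc (card S) - a) = card S"
      using m insert.hyps(1) assms(2) by auto
    then show ?thesis unfolding eq by simp
  next
    case False
    \<comment> \<open>Here the subtraction truncates and the extra term would read
      \<open>q ^ 0\<close>; its binomial vanishes, and both index ranges are empty.\<close>
    then have "card S choose (a - 1) = 0" using assms(2) by (intro binomial_eq_0) auto
    then show ?thesis unfolding eq using False m insert.hyps(1) by (simp del: binomial_eq_0_iff)
  qed
qed

text \<open>\<open>F_poly\<close> evaluated in an arbitrary commutative semiring. The recursion can
  then be run directly at the point \<open>monom 1 r\<close>, which stands for
  \<open>q^r\<close>.\<close>

definition F_at :: "nat list \<Rightarrow> 'a::comm_semiring_1 \<Rightarrow> 'a" where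
  "F_at \<alpha> q = (\<Prod>i<length \<alpha>. \<Sum>j = 0..sum_list (take i \<alpha>).
     of_nat ((\<alpha> ! i - 1 + j) choose (\<alpha> ! i - 1)) * q ^ j)"

lemma F_at_snoc:
  "F_at (\<alpha> @ [a]) q =
    F_at \<alpha> q * (\<Sum>j = 0..sum_list \<alpha>. of_nat ((a - 1 + j) choose (a - 1)) * q ^ j)"
  by (simp add: F_at_def nth_append)

lemma pcompose_F_poly: "pcompose (F_poly \<alpha>) p = F_at \<alpha> p"
proof -
  have "pcompose (monom c j) p = smult c (p ^ j)" for c :: int and j
    by (induction j) (simp_all add: monom_0 monom_Suc pcompose_pCons)
  then show ?thesis
    by (simp add: F_poly_def F_at_def pcompose_prod pcompose_sum of_nat_poly)
qed

lemma sum_osps_eq_F_at: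
  fixes q :: "'a::comm_semiring_1" and S :: "nat set" and stat :: "nat set list \<Rightarrow> nat"
  assumes "finite S" and "card S = sum_list \<alpha>" and "0 \<notin> set \<alpha>"
    and "stat [] = 0"
    and "\<And>S B \<alpha>. finite S \<Longrightarrow> B \<subseteq> S \<Longrightarrow> B \<noteq> {} \<Longrightarrow> 0 \<notin> set \<alpha> \<Longrightarrow>
      \<exists>f. inj_on f (S - B) \<and>
        (\<forall>\<tau>\<in>osps (S - B) \<alpha>. stat (\<tau> @ [B]) = stat (map ((`) f) \<tau>) + card {x \<in> S - B. Min B < x})"
  shows "(\<Sum>\<tau>\<in>osps S \<alpha>. q ^ stat \<tau>) = F_at \<alpha> q"
  using assms(1-3)
proof (induction \<alpha> arbitrary: S rule: rev_induct)
  case Nil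
  then show ?case by (simp add: osps_Nil F_at_def assms(4))
next
  case (snoc a \<alpha>)
  have a: "a \<ge> 1" and \<alpha>: "0 \<notin> set \<alpha>" using snoc.prems(3) by auto
  have "(\<Sum>\<tau>\<in>osps S (\<alpha> @ [a]). q ^ stat \<tau>) =
      (\<Sum>B | B \<subseteq> S \<and> card B = a. \<Sum>\<tau>\<in>osps (S - B) \<alpha>. q ^ stat (\<tau> @ [B]))"
    by (rule sum_osps_snoc[OF snoc.prems(1)])
  also have "\<dots> = (\<Sum>B | B \<subseteq> S \<and> card B = a. F_at \<alpha> q * q ^ card {x \<in> S - B. Min B < x})"
  proof (rule sum.cong[OF refl])
    fix B assume "B \<in> {B. B \<subseteq> S \<and> card B = a}"
    then have B: "B \<subseteq> S" "card B = a" by auto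
    have ne: "B \<noteq> {}" using B a by auto
    obtain f where f: "inj_on f (S - B)" and stat:
      "\<And>\<tau>. \<tau> \<in> osps (S - B) \<alpha> \<Longrightarrow>
        stat (\<tau> @ [B]) = stat (map ((`) f) \<tau>) + card {x \<in> S - B. Min B < x}"
      using assms(5)[OF snoc.prems(1) B(1) ne \<alpha>] by blast
    have "card (f ` (S - B)) = sum_list \<alpha>"
      using B snoc.prems finite_subset[OF B(1)] by (simp add: card_image f card_Diff_subset)
    then have IH: "(\<Sum>\<tau>\<in>osps (f ` (S - B)) \<alpha>. q ^ stat \<tau>) = F_at \<alpha> q"
      using snoc.prems(1) \<alpha> by (intro snoc.IH) auto
    have "(\<Sum>\<tau>\<in>osps (S - B) \<alpha>. q ^ stat (\<tau> @ [B])) =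
        (\<Sum>\<tau>\<in>osps (S - B) \<alpha>. q ^ stat (map ((`) f) \<tau>)) * q ^ card {x \<in> S - B. Min B < x}"
      by (simp add: stat power_add sum_distrib_right)
    then show "(\<Sum>\<tau>\<in>osps (S - B) \<alpha>. q ^ stat (\<tau> @ [B])) =
        F_at \<alpha> q * q ^ card {x \<in> S - B. Min B < x}"
      by (simp add: IH[unfolded sum_osps_image[OF f]])
  qed
  also have "\<dots> = F_at \<alpha> q *
      (\<Sum>j<Suc (card S) - a. of_nat ((a - 1 + j) choose (a - 1)) * q ^ j)"
    by (simp only: sum_distrib_left[symmetric] sum_subsets_above_Min[OF snoc.prems(1) a])
  \<comment> \<open>Since \<open>card S = sum_list \<alpha> + a\<close>, the strict bound
    \<open>Suc (card S) - a\<close> is \<open>sum_list \<alpha> + 1\<close>.\<close>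
  also have "{..<Suc (card S) - a} = {0..sum_list \<alpha>}" using snoc.prems(2) by auto
  finally show ?case by (simp add: F_at_snoc)
qed

lemma sum_osp_inv:
  fixes q :: "'a::comm_semiring_1"
  assumes "finite S" and "card S = sum_list \<alpha>" and "0 \<notin> set \<alpha>"
  shows "(\<Sum>\<tau>\<in>osps S \<alpha>. q ^ osp_inv \<tau>) = F_at \<alpha> q"
proof (rule sum_osps_eq_F_at[OF assms])
  show "osp_inv [] = 0" by (simp add: osp_inv_def)
  fix S B :: "nat set" and \<alpha> :: "nat list"
  assume *: "finite S" "B \<subseteq> S" "B \<noteq> {}" "0 \<notin> set \<alpha>"
  show "\<exists>f. inj_on f (S - B) \<and> (\<forall>\<tau>\<in>osps (S - B) \<alpha>. osp_inv (\<tau> @ [B]) =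
      osp_inv (map ((`) f) \<tau>) + card {x \<in> S - B. Min B < x})"
    \<comment> \<open>For inversions the remaining letters keep their names.\<close>
    by (rule exI[of _ id]) (use * in \<open>auto simp: osp_inv_snoc\<close>)
qed

lemma sum_osp_minimaj:
  fixes q :: "'a::comm_semiring_1"
  assumes "finite S" and "card S = sum_list \<alpha>" and "0 \<notin> set \<alpha>"
  shows "(\<Sum>\<tau>\<in>osps S \<alpha>. q ^ osp_minimaj \<tau>) = F_at \<alpha> q"
proof (rule sum_osps_eq_F_at[OF assms])
  show "osp_minimaj [] = 0"
    by (simp add: osp_minimaj_def arrangements_Nil descent_sum_Nil)
  fix S B :: "nat set" and \<alpha> :: "nat list"
  assume *: "finite S" "B \<subseteq> S" "B \<noteq> {}" "0 \<notin> set \<alpha>"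
  obtain K where K: "\<forall>x\<in>S. x < K" using \<open>finite S\<close> finite_nat_set_iff_bounded by blast
  show "\<exists>f. inj_on f (S - B) \<and> (\<forall>\<tau>\<in>osps (S - B) \<alpha>. osp_minimaj (\<tau> @ [B]) =
      osp_minimaj (map ((`) f) \<tau>) + card {x \<in> S - B. Min B < x})"
    by (rule exI[of _ "rotate_below K (Min B)"])
       (use * K in \<open>auto simp: osp_minimaj_snoc intro: inj_on_rotate_below\<close>)
qed

section \<open>Colorings of ordered set partitions\<close>

definition paint :: "(nat \<Rightarrow> nat) \<Rightarrow> nat set list \<Rightarrow> letter set list" where
  "paint c \<tau> = map ((`) (\<lambda>i. (i, c i))) \<tau>"

lemma erase_colors_paint: "erase_colors (paint c \<tau>) = \<tau>"
  by (simp add: erase_colors_def paint_def image_image map_idI)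

lemma osps_nth_unique:
  assumes "\<tau> \<in> osps S \<alpha>" "l < length \<tau>" "m < length \<tau>" "i \<in> \<tau> ! l" "i \<in> \<tau> ! m"
  shows "l = m"
proof -
  have "sorted_wrt disjnt \<tau>" using assms(1) by (simp add: osps_def)
  then have "\<not> l < m" "\<not> m < l"
    using assms(2-) sorted_wrt_nth_less[of disjnt \<tau>] by (meson disjnt_iff)+
  then show ?thesis by simp
qed

lemma paint_in_colored_osps_of_shape:
  assumes c: "c \<in> {1..n} \<rightarrow>\<^sub>E {0..<r}" and \<tau>: "\<tau> \<in> osps {1..n} \<alpha>" and pos: "0 \<notin> set \<alpha>"
  shows "paint c \<tau> \<in> colored_osps_of_shape n r \<alpha>"
proof -
  have U: "\<Union>(set \<tau>) = {1..n}" and card: "map card \<tau> = \<alpha>" using \<tau> by (auto simp: osps_def)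
  have "\<forall>B\<in>set (paint c \<tau>). B \<noteq> {} \<and> B \<subseteq> alphabet n r"
  proof
    fix B assume that: "B \<in> set (paint c \<tau>)"
    have "B \<in> (`) (\<lambda>i. (i, c i)) ` set \<tau>" using that by (simp add: paint_def)
    then obtain A where A: "A \<in> set \<tau>" "B = (\<lambda>i. (i, c i)) ` A" by (rule imageE)
    have "A \<noteq> {}" using A(1) card pos by force
    moreover have "A \<subseteq> {1..n}" using A(1) U by blast
    ultimately show "B \<noteq> {} \<and> B \<subseteq> alphabet n r" using c A(2) by (auto simp: alphabet_def)
  qed
  moreover have "\<forall>i\<in>{1..n}. \<exists>!(m, d). m < length (paint c \<tau>) \<and> (i, d) \<in> paint c \<tau> ! m"
  proof
    fix i assume "i \<in> {1..n}"
    then obtain A where A: "A \<in> set \<tau>" "i \<in> A" using U by blast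
    then obtain m where m: "m < length \<tau>" "i \<in> \<tau> ! m" by (auto simp: in_set_conv_nth)
    show "\<exists>!(m, d). m < length (paint c \<tau>) \<and> (i, d) \<in> paint c \<tau> ! m"
    proof (rule ex1I[of _ "(m, c i)"])
      show "case (m, c i) of (m, d) \<Rightarrow> m < length (paint c \<tau>) \<and> (i, d) \<in> paint c \<tau> ! m"
        using m by (simp add: paint_def)
      fix p assume p: "case p of (m, d) \<Rightarrow> m < length (paint c \<tau>) \<and> (i, d) \<in> paint c \<tau> ! m"
      obtain l d where [simp]: "p = (l, d)" by (cases p)
      have "l < length \<tau>" "i \<in> \<tau> ! l" "d = c i" using p by (auto simp: paint_def)
      then show "p = (m, c i)" using osps_nth_unique[OF \<tau> _ m(1) _ m(2)] by simp
    qed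
  qed
  moreover have "map card (paint c \<tau>) = \<alpha>"
    unfolding card[symmetric] by (simp add: paint_def card_image inj_on_def)
  ultimately show ?thesis
    unfolding colored_osps_of_shape_def colored_osps_def shape_def by (intro CollectI conjI)
qed

lemma colored_osps_of_shape_imp_paint:
  assumes \<sigma>: "\<sigma> \<in> colored_osps_of_shape n r \<alpha>"
  obtains c \<tau> where "c \<in> {1..n} \<rightarrow>\<^sub>E {0..<r}" "\<tau> \<in> osps {1..n} \<alpha>" "\<sigma> = paint c \<tau>"
proof -
  have "\<forall>B\<in>set \<sigma>. B \<noteq> {} \<and> B \<subseteq> alphabet n r"
    using \<sigma> unfolding colored_osps_of_shape_def colored_osps_def by (elim CollectE conjE)
  then have sub: "B \<subseteq> alphabet n r" if "B \<in> set \<sigma>" for B using that by blast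
  have ex: "\<forall>i\<in>{1..n}. \<exists>!(m, c). m < length \<sigma> \<and> (i, c) \<in> \<sigma> ! m"
    using \<sigma> unfolding colored_osps_of_shape_def colored_osps_def by (elim CollectE conjE)
  have card: "map card \<sigma> = \<alpha>"
    using \<sigma> unfolding colored_osps_of_shape_def shape_def by (elim CollectE conjE)
  \<comment> \<open>\<open>p i\<close> is the pair of block index and color of the unique copy of
    \<open>i\<close>.\<close>
  define p where "p i = (THE (m, c). m < length \<sigma> \<and> (i, c) \<in> \<sigma> ! m)" for i
  have p: "fst (p i) < length \<sigma> \<and> (i, snd (p i)) \<in> \<sigma> ! fst (p i)" if "i \<in> {1..n}" for i
    using theI'[OF bspec[OF ex that]] unfolding p_def[symmetric] by (simp add: case_prod_unfold)
  have p_unique: "m = fst (p i) \<and> c = snd (p i)"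
    if "i \<in> {1..n}" "m < length \<sigma>" "(i, c) \<in> \<sigma> ! m" for i m c
    using the1_equality[OF bspec[OF ex that(1)], of "(m, c)"] that(2,3)
    unfolding p_def[symmetric] by simp
  define c where "c = restrict (\<lambda>i. snd (p i)) {1..n}"
  have uniq: "i \<in> {1..n} \<and> k = fst (p i) \<and> d = c i" if "k < length \<sigma>" "(i, d) \<in> \<sigma> ! k" for i k d
  proof -
    have "i \<in> {1..n}" using sub[of "\<sigma> ! k"] that by (auto simp: alphabet_def)
    then show ?thesis using p_unique[of i k d] that by (simp add: c_def)
  qed
  have mem: "i \<in> {1..n} \<and> d = c i" if "A \<in> set \<sigma>" "(i, d) \<in> A" for A i d
    using uniq that by (metis in_set_conv_nth)
  have "(i, c i) \<in> alphabet n r" if "i \<in> {1..n}" for i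
    using p[OF that] sub[of "\<sigma> ! fst (p i)"] that by (auto simp: c_def)
  then have 1: "c \<in> {1..n} \<rightarrow>\<^sub>E {0..<r}"
    by (auto simp: alphabet_def c_def)
  \<comment> \<open>All letters of a block have the form \<open>(i, c i)\<close>, so erasing the
    colors and painting again restores it.\<close>
  have "(\<lambda>i. (i, c i)) ` fst ` A = A" if "A \<in> set \<sigma>" for A
    using mem[OF that] by (force simp: image_iff)
  then have 2: "\<sigma> = paint c (erase_colors \<sigma>)"
    by (simp add: paint_def erase_colors_def map_idI)
  have "sorted_wrt disjnt (erase_colors \<sigma>)"
    unfolding sorted_wrt_iff_nth_less
  proof (intro allI impI)
    fix k l assume kl: "k < l" "l < length (erase_colors \<sigma>)"
    then have l: "l < length \<sigma>" "k < length \<sigma>" by (auto simp: erase_colors_def)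
    have False if "i \<in> fst ` (\<sigma> ! k)" "i \<in> fst ` (\<sigma> ! l)" for i
    proof -
      from that obtain d e where "(i, d) \<in> \<sigma> ! k" "(i, e) \<in> \<sigma> ! l" by auto
      then have "k = l" using uniq l by metis
      then show False using kl by simp
    qed
    then show "disjnt (erase_colors \<sigma> ! k) (erase_colors \<sigma> ! l)"
      using l unfolding disjnt_iff erase_colors_def by auto
  qed
  moreover have "\<Union>(set (erase_colors \<sigma>)) = {1..n}"
  proof (intro equalityI subsetI)
    fix i assume "i \<in> \<Union>(set (erase_colors \<sigma>))"
    then obtain A d where "A \<in> set \<sigma>" "(i, d) \<in> A" by (auto simp: erase_colors_def)
    then show "i \<in> {1..n}" using mem by blast
  next
    fix i assume "i \<in> {1..n}"
    then have "\<sigma> ! fst (p i) \<in> set \<sigma>" "(i, snd (p i)) \<in> \<sigma> ! fst (p i)" using p by auto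
    then show "i \<in> \<Union>(set (erase_colors \<sigma>))" by (force simp: erase_colors_def)
  qed
  moreover have "card (fst ` A) = card A" if "A \<in> set \<sigma>" for A
    by (rule card_image, rule inj_onI) (metis mem[OF that] prod.collapse)
  then have "map card (erase_colors \<sigma>) = \<alpha>"
    unfolding card[symmetric] by (simp add: erase_colors_def)
  ultimately have "erase_colors \<sigma> \<in> osps {1..n} \<alpha>" by (simp add: osps_def)
  then show thesis using that 1 2 by blast
qed

text \<open>Colors and blocks can be chosen independently. Taking colorings from the extensional
  function space makes the coloring unique, as its values on \<open>{1..n}\<close> can be read off
  the painted blocks.\<close>

lemma bij_betw_paint:
  assumes "0 \<notin> set \<alpha>"
  shows "bij_betw (\<lambda>(c, \<tau>). paint c \<tau>) (({1..n} \<rightarrow>\<^sub>E {0..<r}) \<times> osps {1..n} \<alpha>)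
    (colored_osps_of_shape n r \<alpha>)"
  unfolding bij_betw_def
proof
  show "inj_on (\<lambda>(c, \<tau>). paint c \<tau>) (({1..n} \<rightarrow>\<^sub>E {0..<r}) \<times> osps {1..n} \<alpha>)"
  proof (rule inj_onI, clarify)
    fix c c' \<tau> \<tau>'
    assume c: "c \<in> {1..n} \<rightarrow>\<^sub>E {0..<r}" and c': "c' \<in> {1..n} \<rightarrow>\<^sub>E {0..<r}"
      and \<tau>: "\<tau> \<in> osps {1..n} \<alpha>" and eq: "paint c \<tau> = paint c' \<tau>'"
    have [simp]: "\<tau>' = \<tau>" using eq by (metis erase_colors_paint)
    have "c i = c' i" if "i \<in> {1..n}" for i
    proof -
      have "i \<in> \<Union>(set \<tau>)" using that \<tau> by (simp add: osps_def)
      then obtain A where A: "A \<in> set \<tau>" "i \<in> A" by blast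
      have "(\<lambda>i. (i, c i)) ` A = (\<lambda>i. (i, c' i)) ` A"
        using eq A(1) by (simp add: paint_def)
      then show ?thesis using A(2) by auto
    qed
    then have "c = c'" using c c' by (meson PiE_ext)
    then show "c = c' \<and> \<tau> = \<tau>'" by simp
  qed
  show "(\<lambda>(c, \<tau>). paint c \<tau>) ` (({1..n} \<rightarrow>\<^sub>E {0..<r}) \<times> osps {1..n} \<alpha>) =
      colored_osps_of_shape n r \<alpha>"
  proof (intro equalityI subsetI)
    fix \<sigma> assume "\<sigma> \<in> colored_osps_of_shape n r \<alpha>"
    then show "\<sigma> \<in> (\<lambda>(c, \<tau>). paint c \<tau>) ` (({1..n} \<rightarrow>\<^sub>E {0..<r}) \<times> osps {1..n} \<alpha>)"
      by (rule colored_osps_of_shape_imp_paint) auto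
  next
    fix \<sigma> assume "\<sigma> \<in> (\<lambda>(c, \<tau>). paint c \<tau>) ` (({1..n} \<rightarrow>\<^sub>E {0..<r}) \<times> osps {1..n} \<alpha>)"
    then obtain c \<tau> where "c \<in> {1..n} \<rightarrow>\<^sub>E {0..<r}" "\<tau> \<in> osps {1..n} \<alpha>" "\<sigma> = paint c \<tau>"
      by auto
    then show "\<sigma> \<in> colored_osps_of_shape n r \<alpha>"
      using paint_in_colored_osps_of_shape assms by simp
  qed
qed

lemma sum_list_blocks:
  assumes "sorted_wrt disjnt \<tau>" and "\<forall>A\<in>set \<tau>. finite A"
  shows "(\<Sum>A\<leftarrow>\<tau>. sum g A) = sum g (\<Union>(set \<tau>))"
  using assms
proof (induction \<tau>)
  case (Cons A \<tau>)
  have "A \<inter> \<Union>(set \<tau>) = {}" using Cons.prems(1) by (auto simp: disjnt_iff)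
  then show ?case using Cons by (simp add: sum.union_disjoint)
qed simp

lemma color_sum_paint:
  assumes "\<tau> \<in> osps {1..n} \<alpha>"
  shows "color_sum (paint c \<tau>) = (\<Sum>i=1..n. c i)"
proof -
  have U: "\<Union>(set \<tau>) = {1..n}" using assms by (simp add: osps_def)
  then have "\<forall>A\<in>set \<tau>. finite A" by (metis Union_upper finite_atLeastAtMost finite_subset)
  moreover have "color_sum (paint c \<tau>) = (\<Sum>A\<leftarrow>\<tau>. sum c A)"
    by (simp add: color_sum_def paint_def o_def sum.reindex inj_on_def)
  ultimately show ?thesis
    using sum_list_blocks[of \<tau> c] assms U by (simp add: osps_def)
qed

section \<open>Encoding the colored order by numbers\<close>

text \<open>A two-digit number in base \<open>n + 1\<close>: the leading digit
  \<open>r - c i\<close> puts larger colors first, and the digit \<open>i\<close>, at most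
  \<open>n\<close>, decides between equal colors.\<close>

definition letter_key :: "nat \<Rightarrow> nat \<Rightarrow> (nat \<Rightarrow> nat) \<Rightarrow> nat \<Rightarrow> nat" where
  "letter_key n r c i = (r - c i) * (n + 1) + i"

lemma letter_key_less_iff:
  assumes "i \<le> n" "j \<le> n" "c i < r" "c j < r"
  shows "letter_key n r c i < letter_key n r c j \<longleftrightarrow> (i, c i) \<prec> (j, c j)"
proof -
  have lex: "a * (n + 1) + x < b * (n + 1) + y" if "a < b" "x \<le> n" for a b x y :: nat
  proof -
    have "a * (n + 1) + x < Suc a * (n + 1)" using that(2) by simp
    also have "\<dots> \<le> b * (n + 1)" using that(1) by (intro mult_le_mono1) simp
    finally show ?thesis by simp
  qed
  consider "c j < c i" | "c i = c j" | "c i < c j" by linarith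
  then show ?thesis
  proof cases
    case 1
    then have "letter_key n r c i < letter_key n r c j"
      unfolding letter_key_def using assms by (intro lex) auto
    then show ?thesis using 1 by (simp add: letter_less_def)
  next
    case 2
    then show ?thesis by (simp add: letter_key_def letter_less_def)
  next
    case 3
    then have "letter_key n r c j < letter_key n r c i"
      unfolding letter_key_def using assms by (intro lex) auto
    then show ?thesis using 3 by (simp add: letter_less_def)
  qed
qed

lemma inj_on_letter_key:
  assumes "c \<in> {1..n} \<rightarrow>\<^sub>E {0..<r}"
  shows "inj_on (letter_key n r c) {1..n}"
proof (rule linorder_inj_onI')
  fix i j assume "i \<in> {1..n}" "j \<in> {1..n}" "i < j"
  then have "(i, c i) \<prec> (j, c j) \<or> (j, c j) \<prec> (i, c i)" by (auto simp: letter_less_def)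
  moreover have "c i < r" "c j < r" using assms \<open>i \<in> {1..n}\<close> \<open>j \<in> {1..n}\<close> by auto
  ultimately show "letter_key n r c i \<noteq> letter_key n r c j"
    using letter_key_less_iff[of i n j c r] letter_key_less_iff[of j n i c r]
      \<open>i \<in> {1..n}\<close> \<open>j \<in> {1..n}\<close> by auto
qed

text \<open>All words of \<open>paint c \<tau>\<close> have the same color sum, so only the descent
  part is minimised. For fixed \<open>c\<close> it depends only on comparisons between letters, and
  the keys turn these into comparisons of numbers.\<close>

lemma minimaj_paint:
  assumes \<tau>: "\<tau> \<in> osps {1..n} \<alpha>" and c: "c \<in> {1..n} \<rightarrow>\<^sub>E {0..<r}"
  shows "minimaj r (paint c \<tau>) =
    r * osp_minimaj (map ((`) (letter_key n r c)) \<tau>) + (\<Sum>i=1..n. c i)"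
proof -
  let ?A = "arrangements \<tau>" and ?key = "letter_key n r c" and ?C = "\<Sum>i=1..n. c i"
  have U: "\<Union>(set \<tau>) = {1..n}" and disj: "sorted_wrt disjnt \<tau>" using \<tau> by (auto simp: osps_def)
  then have blk: "\<forall>A\<in>set \<tau>. finite A" by (metis Union_upper finite_atLeastAtMost finite_subset)
  have maj: "maj r (map (\<lambda>i. (i, c i)) \<pi>) = r * descent_sum (<) (map ?key \<pi>) + ?C"
    if "\<pi> \<in> ?A" for \<pi>
  proof -
    have s: "set \<pi> = {1..n}" using set_arrangements[OF that] U by simp
    have "descent_sum (<) (map ?key \<pi>) = descent_sum (\<lambda>i j. (i, c i) \<prec> (j, c j)) \<pi>"
      by (rule descent_sum_map, rule letter_key_less_iff) (use s c in auto)
    also have "\<dots> = descent_sum (\<prec>) (map (\<lambda>i. (i, c i)) \<pi>)"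
      by (rule descent_sum_map[symmetric]) simp
    finally show ?thesis
      using sum.distinct_set_conv_list[OF distinct_arrangements[OF that disj], of c] s
      by (simp add: maj_eq_descent_sum o_def)
  qed
  have "block_words (paint c \<tau>) = map (\<lambda>i. (i, c i)) ` ?A"
    unfolding block_words_eq_arrangements paint_def
    by (rule arrangements_image) (simp add: inj_on_def)
  then have "minimaj r (paint c \<tau>) = Min ((\<lambda>\<pi>. maj r (map (\<lambda>i. (i, c i)) \<pi>)) ` ?A)"
    by (simp only: minimaj_def image_image)
  also have "\<dots> = Min ((\<lambda>\<pi>. r * descent_sum (<) (map ?key \<pi>) + ?C) ` ?A)"
    by (rule arg_cong[of _ _ Min], rule image_cong[OF refl maj])
  also have "\<dots> = Min ((\<lambda>x. r * x + ?C) ` descent_sum (<) ` map ?key ` ?A)"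
    by (simp add: image_image)
  \<comment> \<open>The map taking \<open>x\<close> to \<open>r * x + ?C\<close> is monotone, hence
    commutes with the minimum.\<close>
  also have "\<dots> = r * Min (descent_sum (<) ` map ?key ` ?A) + ?C"
    by (rule mono_Min_commute[symmetric])
       (use finite_arrangements[OF blk] arrangements_nonempty[OF blk] in \<open>auto simp: mono_def\<close>)
  also have "map ?key ` ?A = arrangements (map ((`) ?key) \<tau>)"
    by (rule arrangements_image[symmetric]) (simp only: U inj_on_letter_key[OF c])
  finally show ?thesis by (simp add: osp_minimaj_def)
qed

section \<open>Summing over colorings\<close>

lemma monom_sum_exponent: "monom (1::int) (sum f A) = (\<Prod>x\<in>A. monom 1 (f x))"
proof (induction A rule: infinite_finite_induct)
  case (insert x A)
  then show ?case using mult_monom[of "1::int" "f x" 1 "sum f A"] by simp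
qed simp_all

text \<open>The uncolored statistic \<open>s\<close> may depend on the coloring, as it does for
  minimaj through the keys. It suffices that its generating function does not; the color sums then
  factor out.\<close>

lemma sum_colored_osps:
  assumes pos: "0 \<notin> set \<alpha>"
    and stat: "\<And>c \<tau>. c \<in> {1..n} \<rightarrow>\<^sub>E {0..<r} \<Longrightarrow> \<tau> \<in> osps {1..n} \<alpha> \<Longrightarrow>
      stat (paint c \<tau>) = r * s c \<tau> + (\<Sum>i=1..n. c i)"
    and s: "\<And>c. c \<in> {1..n} \<rightarrow>\<^sub>E {0..<r} \<Longrightarrow>
      (\<Sum>\<tau>\<in>osps {1..n} \<alpha>. monom (1::int) r ^ s c \<tau>) = F_at \<alpha> (monom 1 r)"
  shows "(\<Sum>\<sigma>\<in>colored_osps_of_shape n r \<alpha>. monom (1::int) (stat \<sigma>)) =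
    q_int r ^ n * F_at \<alpha> (monom 1 r)"
proof -
  let ?C = "{1..n} \<rightarrow>\<^sub>E {0..<r}"
  have "(\<Sum>\<sigma>\<in>colored_osps_of_shape n r \<alpha>. monom (1::int) (stat \<sigma>)) =
      (\<Sum>(c, \<tau>)\<in>?C \<times> osps {1..n} \<alpha>. monom 1 (stat (paint c \<tau>)))"
    by (subst sum.reindex_bij_betw[OF bij_betw_paint[OF pos], symmetric])
       (simp add: case_prod_unfold)
  also have "\<dots> = (\<Sum>c\<in>?C. \<Sum>\<tau>\<in>osps {1..n} \<alpha>. monom 1 (stat (paint c \<tau>)))"
    by (rule sum.cartesian_product[symmetric])
  also have "\<dots> = (\<Sum>c\<in>?C. (\<Prod>i=1..n. monom 1 (c i)) * F_at \<alpha> (monom 1 r))"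
  proof (rule sum.cong[OF refl])
    fix c assume c: "c \<in> ?C"
    have "(\<Sum>\<tau>\<in>osps {1..n} \<alpha>. monom (1::int) (stat (paint c \<tau>))) =
        (\<Sum>\<tau>\<in>osps {1..n} \<alpha>. monom 1 (\<Sum>i=1..n. c i) * monom 1 r ^ s c \<tau>)"
      by (rule sum.cong) (simp_all add: stat[OF c] monom_power mult_monom add.commute)
    also have "\<dots> = (\<Prod>i=1..n. monom 1 (c i)) * F_at \<alpha> (monom 1 r)"
      by (simp only: sum_distrib_left[symmetric] s[OF c] monom_sum_exponent)
    finally show "(\<Sum>\<tau>\<in>osps {1..n} \<alpha>. monom (1::int) (stat (paint c \<tau>))) =
        (\<Prod>i=1..n. monom 1 (c i)) * F_at \<alpha> (monom 1 r)" .
  qed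
  \<comment> \<open>Expanding the product of \<open>n\<close> copies of \<open>q_int r\<close>
    chooses a color for each \<open>i\<close>, which is a sum over all colorings.\<close>
  also have "\<dots> = (\<Prod>i=1..n. \<Sum>j\<in>{0..<r}. monom 1 j) * F_at \<alpha> (monom 1 r)"
    by (subst prod_sum_PiE) (simp_all add: sum_distrib_right)
  finally show ?thesis by (simp add: q_int_def atLeast0LessThan)
qed

theorem theorem4p1:
  fixes r n :: nat and \<alpha> :: "nat list"
  assumes "r \<ge> 1" and "n \<ge> 1" and "is_composition \<alpha> n"
  shows "(\<Sum>\<sigma>\<in>colored_osps_of_shape n r \<alpha>. monom (1::int) (colored_inv r \<sigma>))
           = (\<Sum>\<sigma>\<in>colored_osps_of_shape n r \<alpha>. monom (1::int) (minimaj r \<sigma>))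
       \<and> (\<Sum>\<sigma>\<in>colored_osps_of_shape n r \<alpha>. monom (1::int) (minimaj r \<sigma>))
           = q_int r ^ n * pcompose (F_poly \<alpha>) (monom 1 r)"
proof -
  have pos: "0 \<notin> set \<alpha>" and n: "sum_list \<alpha> = n"
    using assms(3) by (auto simp: is_composition_def)
  have "(\<Sum>\<sigma>\<in>colored_osps_of_shape n r \<alpha>. monom (1::int) (colored_inv r \<sigma>)) =
      q_int r ^ n * F_at \<alpha> (monom 1 r)"
    by (rule sum_colored_osps[OF pos, where s = "\<lambda>_. osp_inv"])
       (simp_all add: colored_inv_def erase_colors_paint color_sum_paint sum_osp_inv pos n)
  moreover have "(\<Sum>\<sigma>\<in>colored_osps_of_shape n r \<alpha>. monom (1::int) (minimaj r \<sigma>)) =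
      q_int r ^ n * F_at \<alpha> (monom 1 r)"
  proof (rule sum_colored_osps[OF pos])
    fix c assume c: "c \<in> {1..n} \<rightarrow>\<^sub>E {0..<r}"
    let ?key = "letter_key n r c"
    show "minimaj r (paint c \<tau>) = r * osp_minimaj (map ((`) ?key) \<tau>) + (\<Sum>i=1..n. c i)"
      if "\<tau> \<in> osps {1..n} \<alpha>" for \<tau>
      using minimaj_paint[OF that c] .
    show "(\<Sum>\<tau>\<in>osps {1..n} \<alpha>. monom (1::int) r ^ osp_minimaj (map ((`) ?key) \<tau>)) =
        F_at \<alpha> (monom 1 r)"
      \<comment> \<open>The sum becomes one over the ordered set partitions of the set of keys,
        which has \<open>n\<close> elements for every coloring.\<close>
      unfolding sum_osps_image[OF inj_on_letter_key[OF c],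
          of "\<lambda>\<tau>. monom (1::int) r ^ osp_minimaj \<tau>", symmetric]
      using card_image[OF inj_on_letter_key[OF c]] by (intro sum_osp_minimaj) (simp_all add: n pos)
  qed
  ultimately show ?thesis by (simp add: pcompose_F_poly)
qed

end
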